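(* Let $\mathbf{P}\subset\mathbb{C}$ be nonempty and compact. Suppose $(A,B)\in C_{n,n}(\mathbf{P}) \times C_{n,m}(\mathbf{P})$ is pointwise reachable and has constant Hermite indices. Then there is a multiplication feedback operator $\mathcal{K}: C_{n}(\mathbf{P}) \to C_{m}(\mathbf{P})$, $(\mathcal{K}x)(\theta)=K(\theta)x(\theta)$ with $K\in C_{m,n}(\mathbf{P})$, such that $\mathcal{A}+\mathcal{B}\mathcal{K}$ is exponentially stable.
   Context: $C_n(\mathbf{P})$ and $C_{n,m}(\mathbf{P})$ denote the spaces of continuous functions on $\mathbf{P}$ with values in $\mathbb{C}^n$, respectively $\mathbb{C}^{n\times m}$; $C_n(\mathbf{P})$ carries the supremum norm. Here $\mathcal{A}+\mathcal{B}\mathcal{K}$ denotes the bounded multiplication operator on $C_n(\mathbf{P})$ given by $f\mapsto\big(\theta\mapsto (A(\theta)+B(\theta)K(\theta))f(\theta)\big)$. A bounded operator $\mathcal{G}$ on $C_n(\mathbf{P})$ is called exponentially stable if there are constants $M\ge1$, $\gamma>0$ with $\|e^{t\mathcal{G}}\|\le Me^{-\gamma t}$ for all $t\ge0$. The pair $(A,B)$ is pointwise reachable if for every $\theta\in\mathbf{P}$ the pair $(A(\theta),B(\theta))\in\mathbb{C}^{n\times n}\times\mathbb{C}^{n\times m}$ is reachable, i.e. $\operatorname{rank}(B(\theta),A(\theta)B(\theta),\dots,A(\theta)^{n-1}B(\theta))=n$. Hermite indices: for a reachable pair $(A,B)\in\mathbb{C}^{n\times n}\times\mathbb{C}^{n\times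 m}$ with columns $b_1,\dots,b_m$ of $B$, consider the list $b_1,Ab_1,\dots,A^{n-1}b_1,\dots,b_m,Ab_m,\dots,A^{n-1}b_m$ and select, from left to right, the first linearly independent columns (a vector is selected iff it is not in the span of the vectors preceding it), obtaining $b_1,\dots,A^{h_1-1}b_1,b_2,\dots,A^{h_2-1}b_2,\dots,b_m,\dots,A^{h_m-1}b_m$. The numbers $h_1,\dots,h_m$ are the Hermite indices, with $h_i:=0$ if $b_i$ is not selected. The family has constant Hermite indices if those of $(A(\theta),B(\theta))$ do not depend on $\theta\in\mathbf{P}$. *)

theory Defs
  imports "HOL-Analysis.Analysis"
begin

text \<open>
  The dimensions \<open>n\<close> and \<open>m\<close> are the cardinalities of the finite index types \<open>'n\<close> and \<open>'m\<close>.
  A linear order on an index type plays the role of the numbering \<open>1, \<dots>, n\<close> (resp. \<open>1, \<dots>, m\<close>).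
\<close>

section \<open>Reachability and Hermite indices\<close>

text \<open>The operation \<open>(^)\<close> on \<open>complex^'n^'n\<close> is componentwise, hence not the matrix power.\<close>

primrec mpow :: "complex^'n^'n \<Rightarrow> nat \<Rightarrow> complex^'n^'n" where
  "mpow A 0 = mat 1"
| "mpow A (Suc k) = A ** mpow A k"

text \<open>
  The block matrix \<open>(B, A B, \<dots>, A\<^sup>n\<^sup>-\<^sup>1 B)\<close>. Its columns are indexed by \<open>'n \<times> 'm\<close>: the column
  \<open>(l, j)\<close> is the \<open>j\<close>-th column of the block \<open>A\<^sup>k B\<close>, where \<open>k \<in> {0, \<dots>, n - 1}\<close> is the
  number of indices below \<open>l\<close>.
\<close>

definition reachability_matrix ::
  "complex^'n::{finite,linorder}^'n::{finite,linorder} \<Rightarrow> complex^'m^'n::{finite,linorder} \<Rightarrow>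
    complex^('n::{finite,linorder} \<times> 'm::finite)^'n::{finite,linorder}" where
  "reachability_matrix A B = (\<chi> i p. (mpow A (card {..<fst p}) ** B) $ i $ snd p)"

definition reachable ::
  "complex^'n::{finite,linorder}^'n::{finite,linorder} \<Rightarrow> complex^'m^'n::{finite,linorder} \<Rightarrow> bool" where
  "reachable A B \<longleftrightarrow> rank (reachability_matrix A B) = CARD('n)"

text \<open>
  Membership of \<open>A\<^sup>k b\<^sub>j\<close> in the selection from the list
  \<open>b\<^sub>1, A b\<^sub>1, \<dots>, A\<^sup>n\<^sup>-\<^sup>1 b\<^sub>1, \<dots>, b\<^sub>m, A b\<^sub>m, \<dots>, A\<^sup>n\<^sup>-\<^sup>1 b\<^sub>m\<close>. The span is the complex one,
  \<open>vec.span\<close>; the unqualified \<open>span\<close> is the span over the reals.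
\<close>

definition hermite_selected ::
  "complex^'n^'n \<Rightarrow> complex^'m::{finite,linorder}^'n \<Rightarrow> 'm \<Rightarrow> nat \<Rightarrow> bool" where
  "hermite_selected A B j k \<longleftrightarrow>
     mpow A k *v column j B \<notin>
       vec.span {mpow A l *v column i B | i l. l < CARD('n) \<and> (i < j \<or> i = j \<and> l < k)}"

text \<open>
  If \<open>A\<^sup>k b\<^sub>j\<close> is not selected, neither is \<open>A\<^sup>k\<^sup>+\<^sup>1 b\<^sub>j\<close>. So the selected powers of \<open>b\<^sub>j\<close> are
  \<open>b\<^sub>j, \<dots>, A\<^sup>h\<^sup>-\<^sup>1 b\<^sub>j\<close> with \<open>h\<close> their number, which is \<open>0\<close> if \<open>b\<^sub>j\<close> is not selected.
\<close>

definition hermite_index ::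
  "complex^'n^'n \<Rightarrow> complex^'m::{finite,linorder}^'n \<Rightarrow> 'm \<Rightarrow> nat" where
  "hermite_index A B j = card {k. k < CARD('n) \<and> hermite_selected A B j k}"

definition pointwise_reachable ::
  "complex set \<Rightarrow> (complex \<Rightarrow> complex^'n::{finite,linorder}^'n::{finite,linorder}) \<Rightarrow>
    (complex \<Rightarrow> complex^'m^'n::{finite,linorder}) \<Rightarrow> bool" where
  "pointwise_reachable P A B \<longleftrightarrow> (\<forall>\<theta>\<in>P. reachable (A \<theta>) (B \<theta>))"

definition constant_hermite_indices ::
  "complex set \<Rightarrow> (complex \<Rightarrow> complex^'n^'n) \<Rightarrow>
    (complex \<Rightarrow> complex^'m::{finite,linorder}^'n) \<Rightarrow> bool" where
  "constant_hermite_indices P A B \<longleftrightarrow>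
     (\<forall>\<theta>\<in>P. \<forall>\<theta>'\<in>P. \<forall>j. hermite_index (A \<theta>) (B \<theta>) j = hermite_index (A \<theta>') (B \<theta>') j)"

section \<open>Operators on the space of continuous functions on \<open>P\<close>\<close>

text \<open>
  A function on \<open>P\<close> is represented by its extension by zero, so that it is determined by its
  values on \<open>P\<close>. Continuity is only required on \<open>P\<close>.
\<close>

definition cont_space :: "complex set \<Rightarrow> (complex \<Rightarrow> complex^'n) set" where
  "cont_space P = {f. continuous_on P f \<and> (\<forall>\<theta>. \<theta> \<notin> P \<longrightarrow> f \<theta> = 0)}"

definition sup_norm :: "complex set \<Rightarrow> (complex \<Rightarrow> complex^'n) \<Rightarrow> real" where
  "sup_norm P f = (SUP \<theta>\<in>P. norm (f \<theta>))"

definition mult_op ::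
  "complex set \<Rightarrow> (complex \<Rightarrow> complex^'n^'m) \<Rightarrow> (complex \<Rightarrow> complex^'n) \<Rightarrow> (complex \<Rightarrow> complex^'m)" where
  "mult_op P F f = (\<lambda>\<theta>. if \<theta> \<in> P then F \<theta> *v f \<theta> else 0)"

type_synonym 'n operator = "(complex \<Rightarrow> complex^'n) \<Rightarrow> (complex \<Rightarrow> complex^'n)"

text \<open>Operators matter only through their values on \<^term>\<open>cont_space P\<close>.\<close>

definition bounded_operator :: "complex set \<Rightarrow> 'n::finite operator \<Rightarrow> bool" where
  "bounded_operator P G \<longleftrightarrow>
     (\<forall>f\<in>cont_space P. G f \<in> cont_space P) \<and>
     (\<forall>f\<in>cont_space P. \<forall>g\<in>cont_space P. G (\<lambda>\<theta>. f \<theta> + g \<theta>) = (\<lambda>\<theta>. G f \<theta> + G g \<theta>)) \<and>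
     (\<forall>c. \<forall>f\<in>cont_space P. G (\<lambda>\<theta>. c *s f \<theta>) = (\<lambda>\<theta>. c *s G f \<theta>)) \<and>
     (\<exists>c. \<forall>f\<in>cont_space P. sup_norm P (G f) \<le> c * sup_norm P f)"

definition op_norm :: "complex set \<Rightarrow> 'n::finite operator \<Rightarrow> real" where
  "op_norm P G = (SUP f\<in>{f\<in>cont_space P. sup_norm P f \<le> 1}. sup_norm P (G f))"

text \<open>
  \<open>has_op_exp P G E\<close> says that \<open>E\<close> is the exponential of \<open>G\<close>, that is, the limit in the operator
  norm of the partial sums of \<open>\<Sum>k. G\<^sup>k / k!\<close>. This determines \<open>E\<close> on \<^term>\<open>cont_space P\<close>.
\<close>

definition has_op_exp :: "complex set \<Rightarrow> 'n::finite operator \<Rightarrow> 'n operator \<Rightarrow> bool" where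
  "has_op_exp P G E \<longleftrightarrow> bounded_operator P E \<and>
     (\<lambda>N. op_norm P (\<lambda>f \<theta>. (\<Sum>k<N. (1 / fact k) *\<^sub>R (G ^^ k) f \<theta>) - E f \<theta>)) \<longlonglongrightarrow> 0"

definition exponentially_stable :: "complex set \<Rightarrow> 'n::finite operator \<Rightarrow> bool" where
  "exponentially_stable P G \<longleftrightarrow> bounded_operator P G \<and>
     (\<exists>M \<gamma>. M \<ge> 1 \<and> \<gamma> > 0 \<and>
       (\<forall>t\<ge>0. \<exists>E. has_op_exp P (\<lambda>f \<theta>. t *\<^sub>R G f \<theta>) E \<and> op_norm P E \<le> M * exp (- \<gamma> * t)))"

end

theory Submission
  imports Defs
begin

text \<open>
  The feedback is the one of Bass, which is given by a formula in \<open>A\<close> and \<open>B\<close> and therefore inherits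
  their continuity. Choose \<open>\<beta>\<close> larger than the norm of every \<open>A(\<theta>)\<close>, which is possible as \<open>P\<close> is
  compact. The Lyapunov equation \<open>A Z + Z A\<^sup>* + 2 \<beta> Z = 2 B B\<^sup>*\<close> then has a unique solution \<open>Z(\<theta>)\<close>, since
  the term \<open>2 \<beta> Z\<close> dominates (\<open>lyapunov_map_lower_bound\<close>). Uniqueness makes \<open>Z\<close> Hermitian, and
  reachability makes it positive definite (\<open>lyapunov_solution_positive_definite\<close>).

  Put \<open>Q = Z\<^sup>-\<^sup>1\<close> and \<open>K = - B\<^sup>* Q\<close>. Inserting \<open>K\<close> into the Lyapunov equation gives
  \<open>(A + B K) Z + Z (A + B K)\<^sup>* = - 2 \<beta> Z\<close>, which says that the energy \<open>x\<^sup>* Q x\<close> decays along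
  \<open>x' = (A + B K) x\<close> exactly like \<open>exp (- 2 \<beta> t)\<close> (\<open>bass_feedback_dissipation\<close>, \<open>energy_along_flow\<close>).

  Continuity of \<open>Z\<close> and \<open>Q\<close> follows from the linear equations that determine them
  (\<open>continuous_on_solution\<close>). By compactness the energy is then comparable to the squared Euclidean norm
  with constants that are independent of \<open>\<theta>\<close> (\<open>uniformly_positive_definite\<close>), so that the matrix
  exponentials satisfy one exponential bound on all of \<open>P\<close>. The exponential of a multiplication operator
  is multiplication by the pointwise matrix exponential (\<open>has_op_exp_mult_op\<close>), and the supremum norm
  turns the uniform pointwise bound into a bound of the operator norm.
\<close>

section \<open>Complex matrices with the Frobenius norm\<close>

lemma norm_matrix_vector_mult_le:
  fixes A :: "complex^'n^'m"
  shows "norm (A *v x) \<le> norm A * norm x"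
proof -
  have "norm ((A *v x) $ i) \<le> norm (A $ i) * norm x" for i
  proof -
    have "norm ((A *v x) $ i) \<le> (\<Sum>j\<in>UNIV. norm (A $ i $ j) * norm (x $ j))"
      unfolding matrix_vector_mult_def by (simp add: sum_norm_le norm_mult)
    also have "\<dots> \<le> norm (A $ i) * norm x"
      using L2_set_mult_ineq[of "\<lambda>j. norm (A $ i $ j)" "\<lambda>j. norm (x $ j)" UNIV]
      by (simp add: norm_vec_def)
    finally show ?thesis .
  qed
  then have "norm (A *v x) \<le> L2_set (\<lambda>i. norm (A $ i) * norm x) UNIV"
    unfolding norm_vec_def[of "A *v x"] by (intro L2_set_mono) auto
  also have "\<dots> = norm A * norm x"
    by (simp add: norm_vec_def[of A] L2_set_left_distrib)
  finally show ?thesis .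
qed

lemma norm_matrix_eq:
  fixes A :: "complex^'n^'m"
  shows "norm A = sqrt (\<Sum>i\<in>UNIV. \<Sum>j\<in>UNIV. (norm (A $ i $ j))\<^sup>2)"
  by (simp add: norm_vec_def L2_set_def sum_nonneg)

lemma norm_transpose:
  fixes A :: "complex^'n^'m"
  shows "norm (transpose A) = norm A"
  unfolding norm_matrix_eq transpose_def by (subst sum.swap) simp

lemma norm_matrix_mult_le:
  fixes A :: "complex^'n^'m" and B :: "complex^'k^'n"
  shows "norm (A ** B) \<le> norm A * norm B"
proof -
  have "(A ** B) $ i = transpose B *v A $ i" for i
    by (simp add: vec_eq_iff matrix_matrix_mult_def matrix_vector_mult_def transpose_def mult.commute)
  then have "norm ((A ** B) $ i) \<le> norm (A $ i) * norm B" for i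
    using norm_matrix_vector_mult_le[of "transpose B" "A $ i"] by (simp add: norm_transpose mult.commute)
  then have "norm (A ** B) \<le> L2_set (\<lambda>i. norm (A $ i) * norm B) UNIV"
    unfolding norm_vec_def[of "A ** B"] by (intro L2_set_mono) auto
  also have "\<dots> = norm A * norm B"
    by (simp add: norm_vec_def[of A] L2_set_left_distrib)
  finally show ?thesis .
qed

lemma scaleR_matrix_vector_mult:
  fixes A :: "complex^'n^'m"
  shows "(r *\<^sub>R A) *v x = r *\<^sub>R (A *v x)"
  by (simp add: vec_eq_iff matrix_vector_mult_def scaleR_sum_right)

lemma matrix_vector_mult_scaleR_right:
  fixes A :: "complex^'n^'m"
  shows "A *v (r *\<^sub>R x) = r *\<^sub>R (A *v x)"
  by (simp add: vec_eq_iff matrix_vector_mult_def scaleR_sum_right)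

lemma bounded_bilinear_matrix_vector_mult:
  "bounded_bilinear ((*v) :: complex^'n^'m \<Rightarrow> complex^'n \<Rightarrow> complex^'m)"
proof (rule bounded_bilinear.intro)
  show "\<exists>K. \<forall>(A :: complex^'n^'m) x. norm (A *v x) \<le> norm A * norm x * K"
    by (intro exI[of _ 1]) (simp add: norm_matrix_vector_mult_le)
qed (auto simp: vec_eq_iff matrix_vector_mult_def scaleR_sum_right algebra_simps sum.distrib)

lemma bounded_bilinear_matrix_matrix_mult:
  "bounded_bilinear ((**) :: complex^'n^'m \<Rightarrow> complex^'k^'n \<Rightarrow> complex^'k^'m)"
proof (rule bounded_bilinear.intro)
  show "\<exists>K. \<forall>(A :: complex^'n^'m) (B :: complex^'k^'n). norm (A ** B) \<le> norm A * norm B * K"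
    by (intro exI[of _ 1]) (simp add: norm_matrix_mult_le)
qed (auto simp: vec_eq_iff matrix_matrix_mult_def scaleR_sum_right algebra_simps sum.distrib)

lemmas continuous_on_matrix_vector_mult =
  bounded_bilinear.continuous_on[OF bounded_bilinear_matrix_vector_mult]

lemmas continuous_on_matrix_matrix_mult =
  bounded_bilinear.continuous_on[OF bounded_bilinear_matrix_matrix_mult]

definition conj_transpose :: "complex^'n^'m \<Rightarrow> complex^'m^'n" where
  "conj_transpose A = (\<chi> i j. cnj (A $ j $ i))"

text \<open>
  The real inner product on \<open>complex^'n\<close> is the real part of the Hermitian one, so the conjugate
  transpose is the adjoint with respect to it as well.
\<close>

lemma inner_conj_transpose:
  fixes A :: "complex^'n^'m"
  shows "inner (A *v x) y = inner x (conj_transpose A *v y)"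
proof -
  have "inner (A *v x) y = (\<Sum>i\<in>UNIV. \<Sum>j\<in>UNIV. inner (A $ i $ j * x $ j) (y $ i))"
    by (simp add: inner_vec_def matrix_vector_mult_def inner_sum_left)
  also have "\<dots> = (\<Sum>i\<in>UNIV. \<Sum>j\<in>UNIV. inner (x $ j) (cnj (A $ i $ j) * y $ i))"
    by (intro sum.cong refl) (simp add: inner_complex_def algebra_simps)
  also have "\<dots> = (\<Sum>j\<in>UNIV. \<Sum>i\<in>UNIV. inner (x $ j) (cnj (A $ i $ j) * y $ i))"
    by (rule sum.swap)
  also have "\<dots> = inner x (conj_transpose A *v y)"
    by (simp add: inner_vec_def matrix_vector_mult_def inner_sum_right conj_transpose_def)
  finally show ?thesis .
qed

lemma conj_transpose_conj_transpose [simp]: "conj_transpose (conj_transpose A) = A"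
  by (simp add: conj_transpose_def vec_eq_iff)

lemma conj_transpose_matrix_mult:
  "conj_transpose (A ** B) = conj_transpose B ** conj_transpose A"
  by (simp add: conj_transpose_def vec_eq_iff matrix_matrix_mult_def mult.commute)

lemma conj_transpose_add: "conj_transpose (A + B) = conj_transpose A + conj_transpose B"
  by (simp add: conj_transpose_def vec_eq_iff)

lemma conj_transpose_scaleR: "conj_transpose (r *\<^sub>R A) = r *\<^sub>R conj_transpose A"
  by (simp add: conj_transpose_def vec_eq_iff)

lemma norm_conj_transpose: "norm (conj_transpose A) = norm A"
  unfolding norm_matrix_eq conj_transpose_def by (subst sum.swap) simp

lemma continuous_on_conj_transpose:
  "continuous_on S A \<Longrightarrow> continuous_on S (\<lambda>\<theta>. conj_transpose (A \<theta>))"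
  unfolding conj_transpose_def by (intro continuous_intros)

section \<open>Parameter-dependent linear equations and quadratic forms\<close>

text \<open>
  Both the solution of the Lyapunov equation and the inverse of that solution depend on the parameter
  only through a linear equation, so their continuity needs no formula for them: with a uniform lower
  bound on \<open>T \<theta>\<close>, the difference \<open>u \<theta> - u \<theta>\<^sub>0\<close> is controlled by the residual of the fixed vector
  \<open>u \<theta>\<^sub>0\<close> in the equation at \<open>\<theta>\<close>, and this residual is continuous and vanishes at \<open>\<theta>\<^sub>0\<close>.
\<close>

lemma continuous_on_solution:
  fixes T :: "'p::metric_space \<Rightarrow> 'a::real_normed_vector \<Rightarrow> 'b::real_normed_vector"
  assumes lin: "\<And>\<theta>. \<theta> \<in> P \<Longrightarrow> linear (T \<theta>)"
    and c: "c > 0" and bound: "\<And>\<theta> x. \<theta> \<in> P \<Longrightarrow> c * norm x \<le> norm (T \<theta> x)"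
    and T: "\<And>x. continuous_on P (\<lambda>\<theta>. T \<theta> x)" and b: "continuous_on P b"
    and sol: "\<And>\<theta>. \<theta> \<in> P \<Longrightarrow> T \<theta> (u \<theta>) = b \<theta>"
  shows "continuous_on P u"
  unfolding continuous_on_def
proof
  fix \<theta>0 assume \<theta>0: "\<theta>0 \<in> P"
  let ?d = "\<lambda>\<theta>. norm (b \<theta> - T \<theta> (u \<theta>0)) / c"
  have "continuous_on P ?d"
    using c by (intro continuous_intros b T) auto
  then have "(?d \<longlongrightarrow> ?d \<theta>0) (at \<theta>0 within P)"
    using \<theta>0 unfolding continuous_on_def by blast
  then have lim: "(?d \<longlongrightarrow> 0) (at \<theta>0 within P)"
    using sol[OF \<theta>0] by simp
  have "norm (u \<theta> - u \<theta>0) \<le> ?d \<theta>" if "\<theta> \<in> P" for \<theta>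
    using bound[OF that, of "u \<theta> - u \<theta>0"] c sol[OF that] linear_diff[OF lin[OF that], of "u \<theta>" "u \<theta>0"]
    by (simp add: field_simps)
  then have "\<forall>\<^sub>F \<theta> in at \<theta>0 within P. norm (u \<theta> - u \<theta>0) \<le> ?d \<theta>"
    by (auto simp: eventually_at_filter)
  then have "((\<lambda>\<theta>. u \<theta> - u \<theta>0) \<longlongrightarrow> 0) (at \<theta>0 within P)"
    by (rule Lim_null_comparison[OF _ lim])
  then show "(u \<longlongrightarrow> u \<theta>0) (at \<theta>0 within P)"
    by (simp add: LIM_zero_iff)
qed

lemma continuous_on_quadratic_form:
  fixes Z :: "'p::topological_space \<Rightarrow> complex^'n^'n"
  assumes "continuous_on P Z"
  shows "continuous_on (P \<times> S) (\<lambda>(\<theta>, x). inner x (Z \<theta> *v x))"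
proof -
  have "continuous_on (P \<times> S) (\<lambda>p. Z (fst p))"
    by (intro continuous_on_compose2[OF assms] continuous_intros) auto
  then show ?thesis
    unfolding case_prod_unfold by (intro continuous_intros continuous_on_matrix_vector_mult)
qed

lemma uniformly_positive_definite:
  fixes Z :: "'p::metric_space \<Rightarrow> complex^'n^'n"
  assumes P: "compact P" "P \<noteq> {}" and Z: "continuous_on P Z"
    and pos: "\<And>\<theta> x. \<theta> \<in> P \<Longrightarrow> x \<noteq> 0 \<Longrightarrow> 0 < inner x (Z \<theta> *v x)"
  obtains q where "q > 0" "\<And>\<theta> x. \<theta> \<in> P \<Longrightarrow> q * (norm x)\<^sup>2 \<le> inner x (Z \<theta> *v x)"
proof -
  let ?S = "sphere (0 :: complex^'n) 1"
  have ne: "P \<times> ?S \<noteq> {}" and comp: "compact (P \<times> ?S)"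
    using P by (auto simp: compact_Times)
  obtain p where p: "p \<in> P \<times> ?S" and
    min: "\<And>r. r \<in> P \<times> ?S \<Longrightarrow> (\<lambda>(\<theta>, x). inner x (Z \<theta> *v x)) p \<le> (\<lambda>(\<theta>, x). inner x (Z \<theta> *v x)) r"
    using continuous_attains_inf[OF comp ne continuous_on_quadratic_form[OF Z]] by blast
  obtain \<theta>0 x0 where [simp]: "p = (\<theta>0, x0)" by (cases p)
  let ?q = "inner x0 (Z \<theta>0 *v x0)"
  show ?thesis
  proof
    show "?q > 0" using p by (intro pos) auto
    fix \<theta> x assume \<theta>: "\<theta> \<in> P"
    show "?q * (norm x)\<^sup>2 \<le> inner x (Z \<theta> *v x)"
    proof (cases "x = 0")
      case False
      let ?e = "(1 / norm x) *\<^sub>R x"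
      have "?q \<le> inner ?e (Z \<theta> *v ?e)"
        using min[of "(\<theta>, ?e)"] \<theta> False by auto
      also have "\<dots> = inner x (Z \<theta> *v x) / (norm x)\<^sup>2"
        by (simp add: matrix_vector_mult_scaleR_right power2_eq_square)
      finally show ?thesis using False by (simp add: field_simps)
    qed simp
  qed
qed

text \<open>
  The shifted map \<open>g y = f y - \<mu> y\<close>, with \<open>\<mu>\<close> the minimum, has a nonnegative form that vanishes at \<open>x\<close>.
  If \<open>g x\<close> were nonzero, a small step from \<open>x\<close> in the direction \<open>- g x\<close> would make the form negative,
  since its first-order change is \<open>- 2 |g x|\<^sup>2\<close>.
\<close>

lemma symmetric_minimizer_eigenvector:
  fixes f :: "'a::real_inner \<Rightarrow> 'a"
  assumes lin: "linear f" and sym: "\<And>x y. inner (f x) y = inner x (f y)"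
    and x: "norm x = 1" and min: "\<And>y. norm y = 1 \<Longrightarrow> inner x (f x) \<le> inner y (f y)"
  shows "f x = inner x (f x) *\<^sub>R x"
proof (rule ccontr)
  define \<mu> where "\<mu> = inner x (f x)"
  define g where "g = (\<lambda>y. f y - \<mu> *\<^sub>R y)"
  assume "f x \<noteq> inner x (f x) *\<^sub>R x"
  then have gx: "g x \<noteq> 0" by (simp add: g_def \<mu>_def)
  have nonneg: "0 \<le> inner y (g y)" for y
  proof (cases "y = 0")
    case False
    let ?e = "(1 / norm y) *\<^sub>R y"
    have "\<mu> \<le> inner ?e (f ?e)"
      unfolding \<mu>_def using False by (intro min) simp
    also have "\<dots> = inner y (f y) / (norm y)\<^sup>2"
      by (simp add: linear_scale[OF lin] power2_eq_square)
    finally show ?thesis using False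
      by (simp add: field_simps g_def inner_diff_right power2_norm_eq_inner)
  qed simp
  have g_lin: "g (y - s *\<^sub>R z) = g y - s *\<^sub>R g z" for y z s
    by (simp add: g_def linear_diff[OF lin] linear_scale[OF lin] algebra_simps)
  have g_sym: "inner y (g z) = inner (g y) z" for y z
    by (simp add: g_def inner_diff_left inner_diff_right sym)
  have zero: "inner x (g x) = 0"
    using x by (simp add: g_def \<mu>_def inner_diff_right norm_eq_1)
  (* the step s makes the quadratic term s^2 b at most s a, half of the linear gain 2 s a *)
  define a b s where "a = inner (g x) (g x)" "b = inner (g x) (g (g x))" "s = a / (b + 1)"
  have a: "a > 0" and b: "b \<ge> 0" using gx nonneg by (auto simp: a_b_s_def)
  then have s: "s > 0" by (simp add: a_b_s_def)
  have "0 \<le> inner (x - s *\<^sub>R g x) (g (x - s *\<^sub>R g x))" by (rule nonneg)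
  also have "\<dots> = s * (s * b - 2 * a)"
    by (simp add: g_lin inner_diff_left inner_diff_right zero a_b_s_def g_sym[of x "g x"] algebra_simps)
  finally have "s * b \<ge> 2 * a" using s by (simp add: zero_le_mult_iff)
  moreover have "s * b \<le> a" using a b by (simp add: a_b_s_def field_simps)
  ultimately show False using a by simp
qed

section \<open>The Lyapunov equation of a reachable pair\<close>

definition lyapunov_map :: "complex^'n^'n \<Rightarrow> real \<Rightarrow> complex^'n^'n \<Rightarrow> complex^'n^'n" where
  "lyapunov_map A \<beta> Z = A ** Z + Z ** conj_transpose A + (2 * \<beta>) *\<^sub>R Z"

lemma linear_lyapunov_map: "linear (lyapunov_map A \<beta>)"
  unfolding lyapunov_map_def
  by (intro linear_compose_add bounded_linear.linear[OF bounded_bilinear.bounded_linear_left]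
      bounded_linear.linear[OF bounded_bilinear.bounded_linear_right]
      bounded_bilinear_matrix_matrix_mult linear_compose_scale_right linear_id[unfolded id_def])

text \<open>
  For \<open>\<beta>\<close> above the norm of \<open>A\<close> the multiple \<open>2 \<beta> Z\<close> dominates the two other terms. This gives
  unique solvability at each parameter value, and a bound that is uniform over parameters.
\<close>

lemma lyapunov_map_lower_bound:
  "2 * (\<beta> - norm A) * norm Z \<le> norm (lyapunov_map A \<beta> Z)"
proof -
  have "norm ((2 * \<beta>) *\<^sub>R Z) \<le> norm (lyapunov_map A \<beta> Z) + norm (A ** Z + Z ** conj_transpose A)"
    using norm_triangle_ineq4[of "lyapunov_map A \<beta> Z" "A ** Z + Z ** conj_transpose A"]
    by (simp add: lyapunov_map_def)
  moreover have "norm (A ** Z + Z ** conj_transpose A) \<le> 2 * norm A * norm Z"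
    using norm_triangle_ineq[of "A ** Z" "Z ** conj_transpose A"]
      norm_matrix_mult_le[of A Z] norm_matrix_mult_le[of Z "conj_transpose A"]
    by (simp add: norm_conj_transpose mult.commute[of "norm Z"])
  moreover have "2 * \<beta> * norm Z \<le> norm ((2 * \<beta>) *\<^sub>R Z)"
    by (simp add: mult_right_mono)
  ultimately show ?thesis by (simp add: algebra_simps)
qed

lemma bij_lyapunov_map:
  assumes "norm A < \<beta>"
  shows "bij (lyapunov_map A \<beta>)"
proof -
  have "Z = 0" if "lyapunov_map A \<beta> Z = 0" for Z
    using lyapunov_map_lower_bound[of \<beta> A Z] assms that by (simp add: mult_le_0_iff)
  then have "inj (lyapunov_map A \<beta>)"
    using linear_injective_0[OF linear_lyapunov_map] by blast
  then show ?thesis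
    by (simp add: bij_def linear_injective_imp_surjective[OF linear_lyapunov_map])
qed

lemma conj_transpose_lyapunov_map:
  "conj_transpose (lyapunov_map A \<beta> Z) = lyapunov_map A \<beta> (conj_transpose Z)"
  by (simp add: lyapunov_map_def conj_transpose_add conj_transpose_scaleR conj_transpose_matrix_mult
      add.commute)

lemma lyapunov_solution_hermitian:
  assumes "norm A < \<beta>" and "lyapunov_map A \<beta> Z = C" and "conj_transpose C = C"
  shows "conj_transpose Z = Z"
proof -
  have "lyapunov_map A \<beta> (conj_transpose Z) = lyapunov_map A \<beta> Z"
    using assms(2,3) by (simp flip: conj_transpose_lyapunov_map)
  then show ?thesis
    using bij_lyapunov_map[OF assms(1)] by (simp add: bij_def inj_eq)
qed

text \<open>
  A linear relation between the rows with a nonzero coefficient makes one row redundant, so the row rank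
  falls below their number.
\<close>

lemma reachable_left_kernel:
  fixes A :: "complex^'n::{finite,linorder}^'n::{finite,linorder}" and B :: "complex^'m^'n::{finite,linorder}"
  assumes r: "reachable A B" and c: "\<And>k j. (\<Sum>i\<in>UNIV. c i * (mpow A k ** B) $ i $ j) = 0"
  shows "c i = 0"
proof (rule ccontr)
  let ?R = "reachability_matrix A B"
  assume i: "c i \<noteq> 0"
  have "(\<Sum>l\<in>UNIV. c l *s row l ?R) = 0"
    by (simp add: vec_eq_iff row_def reachability_matrix_def c)
  then have "c i *s row i ?R = - (\<Sum>l\<in>UNIV - {i}. c l *s row l ?R)"
    by (simp add: sum.remove[of _ i] eq_neg_iff_add_eq_0)
  then have "row i ?R = (\<Sum>l\<in>UNIV - {i}. (- (c l / c i)) *s row l ?R)"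
  proof -
    assume eq: "c i *s row i ?R = - (\<Sum>l\<in>UNIV - {i}. c l *s row l ?R)"
    have "row i ?R = (1 / c i) *s (c i *s row i ?R)" using i by (simp add: vec_eq_iff)
    then show ?thesis unfolding eq
      using i by (simp add: vec_eq_iff sum_divide_distrib sum_negf sum_distrib_left)
  qed
  also have "\<dots> \<in> vec.span ((\<lambda>l. row l ?R) ` (UNIV - {i}))"
    by (intro vec.span_sum vec.span_scale vec.span_base) auto
  finally have ri: "row i ?R \<in> vec.span ((\<lambda>l. row l ?R) ` (UNIV - {i}))" .
  have "row l ?R \<in> vec.span ((\<lambda>l. row l ?R) ` (UNIV - {i}))" for l
    by (cases "l = i") (use ri in \<open>auto intro: vec.span_base\<close>)
  then have "rows ?R \<subseteq> vec.span ((\<lambda>l. row l ?R) ` (UNIV - {i}))"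
    by (auto simp: rows_def)
  then have "rank ?R \<le> card ((\<lambda>l. row l ?R) ` (UNIV - {i}))"
    unfolding row_rank_def_gen by (intro vec.dim_le_card) auto
  also have "\<dots> \<le> card (UNIV - {i})" by (intro card_image_le) auto
  also have "\<dots> < CARD('n)" by (intro psubset_card_mono) auto
  finally show False using r by (simp add: reachable_def)
qed

lemma mpow_conj_transpose: "mpow (conj_transpose A) k = conj_transpose (mpow A k)"
proof (induction k)
  case 0
  then show ?case by (simp add: conj_transpose_def mat_def vec_eq_iff)
next
  case (Suc k)
  have "mpow (conj_transpose A) (Suc k) = conj_transpose (mpow A k ** A)"
    by (simp add: Suc conj_transpose_matrix_mult)
  also have "mpow A k ** A = mpow A (Suc k)"
    by (induction k) (simp_all flip: matrix_mul_assoc)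
  finally show ?case .
qed

lemma reachable_observability:
  fixes A :: "complex^'n::{finite,linorder}^'n::{finite,linorder}" and B :: "complex^'m^'n::{finite,linorder}"
  assumes r: "reachable A B"
    and x: "\<And>k. conj_transpose B *v (mpow (conj_transpose A) k *v x) = 0"
  shows "x = 0"
proof -
  have "(\<Sum>i\<in>UNIV. cnj (x $ i) * (mpow A k ** B) $ i $ j) = 0" for k j
  proof -
    have "conj_transpose (mpow A k ** B) *v x = 0"
      using x[of k] by (simp add: conj_transpose_matrix_mult mpow_conj_transpose matrix_vector_mul_assoc)
    then have "cnj ((conj_transpose (mpow A k ** B) *v x) $ j) = 0" by simp
    then have "(\<Sum>i\<in>UNIV. cnj (conj_transpose (mpow A k ** B) $ j $ i) * cnj (x $ i)) = 0"
      unfolding matrix_vector_mult_def by simp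
    then show ?thesis by (simp add: conj_transpose_def mult.commute)
  qed
  from reachable_left_kernel[OF r this] show ?thesis by (simp add: vec_eq_iff)
qed

text \<open>
  The Lyapunov equation read as an identity of quadratic forms: since \<open>Z\<close> is Hermitian, \<open>A Z\<close> and
  \<open>Z A\<^sup>*\<close> contribute the same amount.
\<close>

lemma lyapunov_form:
  assumes "lyapunov_map A \<beta> Z = 2 *\<^sub>R (B ** conj_transpose B)" and Z: "conj_transpose Z = Z"
  shows "inner x (A *v (Z *v x)) + \<beta> * inner x (Z *v x) = (norm (conj_transpose B *v x))\<^sup>2"
proof -
  have "inner x (Z *v (conj_transpose A *v x)) = inner (A *v (Z *v x)) x"
    using inner_conj_transpose[of Z x "conj_transpose A *v x"] Z inner_conj_transpose[of A "Z *v x" x] by simp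
  moreover have "inner x (B *v (conj_transpose B *v x)) = (norm (conj_transpose B *v x))\<^sup>2"
    using inner_conj_transpose[of B "conj_transpose B *v x" x]
    by (simp add: inner_commute power2_norm_eq_inner)
  moreover have "inner x (lyapunov_map A \<beta> Z *v x) = inner x ((2 *\<^sub>R (B ** conj_transpose B)) *v x)"
    using assms(1) by simp
  ultimately show ?thesis
    by (simp add: lyapunov_map_def matrix_vector_mult_add_rdistrib scaleR_matrix_vector_mult
        inner_add_right inner_commute flip: matrix_vector_mul_assoc)
qed

text \<open>
  In the variable \<open>y = Q x\<close> the feedback contributes \<open>- |B\<^sup>* y|\<^sup>2\<close>, which is exactly the right-hand side
  of the identity above; what is left is a pure multiple of the energy. This is why the equation is
  posed with the factor \<open>2\<close> in front of \<open>B B\<^sup>*\<close>.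
\<close>

lemma bass_feedback_dissipation:
  assumes sol: "lyapunov_map A \<beta> Z = 2 *\<^sub>R (B ** conj_transpose B)" and herm: "conj_transpose Z = Z"
    and inv: "Z ** Q = mat 1"
  shows "inner ((A + B ** (- (conj_transpose B ** Q))) *v x) (Q *v x) = - \<beta> * inner x (Q *v x)"
proof -
  define y where "y = Q *v x"
  have x: "x = Z *v y" using inv by (simp add: y_def matrix_vector_mul_assoc)
  have "(A + B ** (- (conj_transpose B ** Q))) *v x = A *v x - B *v (conj_transpose B *v y)"
    by (simp add: y_def matrix_vector_mult_add_rdistrib matrix_vector_mult_diff_rdistrib matrix_vector_mul_assoc
        bounded_bilinear.minus_right[OF bounded_bilinear_matrix_matrix_mult]
        bounded_bilinear.minus_left[OF bounded_bilinear_matrix_vector_mult] matrix_mul_assoc)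
  then have "inner ((A + B ** (- (conj_transpose B ** Q))) *v x) y
      = inner y (A *v x) - (norm (conj_transpose B *v y))\<^sup>2"
    using inner_conj_transpose[of B "conj_transpose B *v y" y]
    by (simp add: inner_diff_left inner_diff_right power2_norm_eq_inner inner_commute)
  also have "\<dots> = - \<beta> * inner y x"
    using lyapunov_form[OF sol herm, of y] by (simp add: x)
  finally show ?thesis by (simp add: y_def inner_commute)
qed

text \<open>
  A minimiser \<open>e\<close> of the form of \<open>Z\<close> on the unit sphere is an eigenvector, say for \<open>\<mu>\<close>, and the form
  identity at \<open>e\<close> reads \<open>\<mu> (Re (e\<^sup>* A e) + \<beta>) = |B\<^sup>* e|\<^sup>2\<close>. The bracket is positive because \<open>|A| < \<beta>\<close>,
  so \<open>\<mu> \<ge> 0\<close>. Reachability excludes \<open>\<mu> = 0\<close>: the kernel of \<open>Z\<close> lies in the kernel of \<open>B\<^sup>*\<close> and is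
  invariant under \<open>A\<^sup>*\<close>, so a nonzero element would be an unobservable state of \<open>(A\<^sup>*, B\<^sup>*)\<close>.
\<close>

lemma lyapunov_solution_positive_definite:
  fixes A :: "complex^'n::{finite,linorder}^'n::{finite,linorder}" and B :: "complex^'m^'n::{finite,linorder}"
  assumes r: "reachable A B" and \<beta>: "norm A < \<beta>"
    and sol: "lyapunov_map A \<beta> Z = 2 *\<^sub>R (B ** conj_transpose B)"
    and "x \<noteq> 0"
  shows "0 < inner x (Z *v x)"
proof -
  have herm: "conj_transpose Z = Z"
    by (rule lyapunov_solution_hermitian[OF \<beta> sol])
       (simp add: conj_transpose_scaleR conj_transpose_matrix_mult)
  let ?h = "\<lambda>y. inner y (Z *v y)"
  have "continuous_on (sphere 0 1) ?h"
    by (intro continuous_intros continuous_on_matrix_vector_mult)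
  then obtain e where e: "norm e = 1" and min: "\<And>y. norm y = 1 \<Longrightarrow> ?h e \<le> ?h y"
    using continuous_attains_inf[of "sphere 0 1" ?h] by auto
  have lin: "linear ((*v) Z)"
    by (intro bounded_linear.linear bounded_bilinear.bounded_linear_right
        bounded_bilinear_matrix_vector_mult)
  define \<mu> where "\<mu> = ?h e"
  have Ze: "Z *v e = \<mu> *\<^sub>R e"
    unfolding \<mu>_def
    by (rule symmetric_minimizer_eigenvector[OF lin _ e min]) (simp_all add: inner_conj_transpose herm)
  have "norm (A *v e) \<le> norm A"
    using norm_matrix_vector_mult_le[of A e] e by simp
  then have "\<bar>inner e (A *v e)\<bar> < \<beta>"
    using Cauchy_Schwarz_ineq2[of e "A *v e"] e \<beta> by simp
  then have coeff: "inner e (A *v e) + \<beta> > 0" by linarith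
  have id: "\<mu> * (inner e (A *v e) + \<beta>) = (norm (conj_transpose B *v e))\<^sup>2"
    using lyapunov_form[OF sol herm, of e] e
    by (simp add: Ze matrix_vector_mult_scaleR_right norm_eq_1 algebra_simps)
  have "\<mu> \<noteq> 0"
  proof
    assume "\<mu> = 0"
    have Z0: "Z *v (mpow (conj_transpose A) k *v e) = 0 \<and>
        conj_transpose B *v (mpow (conj_transpose A) k *v e) = 0" for k
    proof -
      have step: "conj_transpose B *v y = 0 \<and> Z *v (conj_transpose A *v y) = 0" if y: "Z *v y = 0" for y
      proof -
        have B0: "conj_transpose B *v y = 0"
          using lyapunov_form[OF sol herm, of y] y by simp
        moreover have "lyapunov_map A \<beta> Z *v y = 0"
          unfolding sol using B0 by (simp add: scaleR_matrix_vector_mult flip: matrix_vector_mul_assoc)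
        ultimately show ?thesis
          using y by (simp add: lyapunov_map_def matrix_vector_mult_add_rdistrib
              scaleR_matrix_vector_mult flip: matrix_vector_mul_assoc)
      qed
      have "Z *v (mpow (conj_transpose A) k *v e) = 0"
      proof (induction k)
        case 0
        then show ?case using Ze \<open>\<mu> = 0\<close> by simp
      next
        case (Suc k)
        then show ?case using step by (simp flip: matrix_vector_mul_assoc)
      qed
      then show ?thesis using step by simp
    qed
    then have "e = 0" using reachable_observability[OF r] by blast
    then show False using e by simp
  qed
  moreover have "\<mu> \<ge> 0"
    using id coeff by (metis zero_le_mult_iff zero_le_power2 not_less)
  ultimately have "\<mu> > 0" by simp
  have "\<mu> \<le> ?h ((1 / norm x) *\<^sub>R x)"
    unfolding \<mu>_def using \<open>x \<noteq> 0\<close> by (intro min) simp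
  then have "\<mu> \<le> inner x (Z *v x) / (norm x * norm x)"
    by (simp add: matrix_vector_mult_scaleR_right)
  with \<open>\<mu> > 0\<close> have "0 < inner x (Z *v x) / (norm x * norm x)" by linarith
  then show ?thesis using \<open>x \<noteq> 0\<close> by (simp add: zero_less_divide_iff)
qed

section \<open>The matrix exponential\<close>

definition matrix_exp :: "complex^'n^'n \<Rightarrow> complex^'n^'n" where
  "matrix_exp X = (\<Sum>k. (1 / fact k) *\<^sub>R mpow X k)"

lemma norm_mpow_le: "norm (mpow X k) \<le> norm (mat 1 :: complex^'n^'n) * norm X ^ k"
  for X :: "complex^'n^'n"
proof (induction k)
  case (Suc k)
  have "norm (mpow X (Suc k)) \<le> norm X * norm (mpow X k)"
    by (simp add: norm_matrix_mult_le)
  also have "\<dots> \<le> norm X * (norm (mat 1 :: complex^'n^'n) * norm X ^ k)"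
    by (intro mult_left_mono Suc) simp
  finally show ?case by (simp add: mult_ac)
qed simp

lemma mpow_scaleR: "mpow (r *\<^sub>R X) k = r ^ k *\<^sub>R mpow X k"
proof (induction k)
  case (Suc k)
  then show ?case
    by (simp add: bounded_bilinear.scaleR_left[OF bounded_bilinear_matrix_matrix_mult]
        bounded_bilinear.scaleR_right[OF bounded_bilinear_matrix_matrix_mult])
qed simp

lemma norm_exp_term_le:
  fixes X :: "complex^'n^'n"
  assumes "norm X \<le> r"
  shows "norm ((1 / fact k) *\<^sub>R mpow X k) \<le> norm (mat 1 :: complex^'n^'n) * (r ^ k /\<^sub>R fact k)"
proof -
  have "norm (mpow X k) \<le> norm (mat 1 :: complex^'n^'n) * r ^ k"
    using norm_mpow_le[of X k] power_mono[OF assms, of k]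
    by (meson mult_left_mono norm_ge_zero order_trans)
  then show ?thesis by (simp add: field_simps)
qed

lemma summable_exp_bound: "summable (\<lambda>k. c * (r ^ k /\<^sub>R fact k))" for r c :: real
  by (intro summable_mult summable_exp_generic)

lemma summable_matrix_exp: "summable (\<lambda>k. (1 / fact k) *\<^sub>R mpow X k)"
  by (rule summable_comparison_test'[OF summable_exp_bound norm_exp_term_le[OF order_refl]])

lemma uniform_limit_matrix_exp:
  assumes "\<And>\<theta>. \<theta> \<in> P \<Longrightarrow> norm (X \<theta>) \<le> r"
  shows "uniform_limit P (\<lambda>N \<theta>. \<Sum>k<N. (1 / fact k) *\<^sub>R mpow (X \<theta>) k)
           (\<lambda>\<theta>. matrix_exp (X \<theta>)) sequentially"
  unfolding matrix_exp_def
  by (rule Weierstrass_m_test[OF norm_exp_term_le summable_exp_bound]) (rule assms)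

lemma continuous_on_mpow: "continuous_on P X \<Longrightarrow> continuous_on P (\<lambda>\<theta>. mpow (X \<theta>) k)"
  by (induction k) (auto intro: continuous_on_matrix_matrix_mult)

lemma continuous_on_matrix_exp:
  assumes "compact P" and X: "continuous_on P X"
  shows "continuous_on P (\<lambda>\<theta>. matrix_exp (X \<theta>))"
proof -
  obtain r where r: "\<And>\<theta>. \<theta> \<in> P \<Longrightarrow> norm (X \<theta>) \<le> r"
    using compact_imp_bounded[OF compact_continuous_image[OF X \<open>compact P\<close>]]
    by (auto simp: bounded_iff)
  show ?thesis
    by (rule uniform_limit_theorem[OF _ uniform_limit_matrix_exp[OF r]])
       (auto intro!: always_eventually continuous_intros continuous_on_mpow X)
qed

lemma matrix_exp_0: "matrix_exp 0 = (mat 1 :: complex^'n^'n)"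
proof -
  have "mpow (0 :: complex^'n^'n) k = 0" if "k \<notin> {0}" for k
    using that by (cases k) (auto simp: bounded_bilinear.zero_left[OF bounded_bilinear_matrix_matrix_mult])
  then show ?thesis
    unfolding matrix_exp_def by (subst suminf_finite[of "{0}"]) auto
qed

lemma has_vector_derivative_vecI:
  fixes f :: "real \<Rightarrow> 'a::real_normed_vector^'n"
  assumes "\<And>i. ((\<lambda>t. f t $ i) has_vector_derivative D $ i) (at t)"
  shows "(f has_vector_derivative D) (at t)"
  using assms unfolding has_vector_derivative_def has_derivative_def
  by (auto intro!: vec_tendstoI bounded_linear_scaleR_left)

text \<open>
  Each entry of \<open>matrix_exp (t X)\<close> is a power series in \<open>t\<close> that converges everywhere, so it can be
  differentiated termwise. Taking entries reduces the matter to scalar series, at the price of regarding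
  \<open>t\<close> as a complex variable.
\<close>

lemma has_vector_derivative_matrix_exp:
  fixes X :: "complex^'n^'n"
  shows "((\<lambda>t. matrix_exp (t *\<^sub>R X)) has_vector_derivative X ** matrix_exp (t *\<^sub>R X)) (at t)"
proof (intro has_vector_derivative_vecI)
  fix i j
  define c where "c = (\<lambda>k. mpow X k $ i $ j / fact k)"
  let ?entry = "\<lambda>Y :: complex^'n^'n. Y $ i $ j"
  have entry: "bounded_linear ?entry"
    by (intro bounded_linear_compose[OF bounded_linear_vec_nth] bounded_linear_vec_nth)
  have summ: "summable (\<lambda>k. c k * y ^ k)" for y
  proof (rule summable_comparison_test'[OF summable_exp_bound])
    fix k :: nat
    have "norm (mpow X k $ i $ j) \<le> norm (mat 1 :: complex^'n^'n) * norm X ^ k"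
      using Finite_Cartesian_Product.norm_nth_le[of "mpow X k $ i" j]
        Finite_Cartesian_Product.norm_nth_le[of "mpow X k" i] norm_mpow_le[of X k] by linarith
    then have "norm (mpow X k $ i $ j) * norm y ^ k
        \<le> norm (mat 1 :: complex^'n^'n) * norm X ^ k * norm y ^ k"
      by (intro mult_right_mono) auto
    then show "norm (c k * y ^ k) \<le> norm (mat 1 :: complex^'n^'n) * ((norm X * norm y) ^ k /\<^sub>R fact k)"
      by (simp add: c_def norm_mult norm_divide norm_power field_simps)
  qed
  have val: "matrix_exp (s *\<^sub>R X) $ i $ j = (\<Sum>k. c k * of_real s ^ k)" for s
    unfolding matrix_exp_def bounded_linear.suminf[OF entry summable_matrix_exp]
    by (simp add: mpow_scaleR c_def) (simp add: scaleR_conv_of_real field_simps)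
  have "(X ** matrix_exp (t *\<^sub>R X)) $ i $ j = (\<Sum>k. (X ** ((1 / fact k) *\<^sub>R mpow (t *\<^sub>R X) k)) $ i $ j)"
    unfolding matrix_exp_def
    by (intro bounded_linear.suminf[OF _ summable_matrix_exp, of "\<lambda>Y. (X ** Y) $ i $ j"]
        bounded_linear_compose[OF entry] bounded_bilinear.bounded_linear_right
        bounded_bilinear_matrix_matrix_mult)
  also have "\<dots> = (\<Sum>k. diffs c k * of_real t ^ k)"
    by (rule suminf_cong)
       (simp add: diffs_def c_def mpow_scaleR
          bounded_bilinear.scaleR_right[OF bounded_bilinear_matrix_matrix_mult] del: of_nat_Suc,
        simp add: scaleR_conv_of_real field_simps del: of_nat_Suc)
  finally have der: "(X ** matrix_exp (t *\<^sub>R X)) $ i $ j = (\<Sum>k. diffs c k * of_real t ^ k)" .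
  show "((\<lambda>t. matrix_exp (t *\<^sub>R X) $ i $ j) has_vector_derivative (X ** matrix_exp (t *\<^sub>R X)) $ i $ j) (at t)"
    unfolding val der
    by (rule has_vector_derivative_real_field[OF termdiffs_strong_converges_everywhere[OF summ]])
qed

text \<open>
  The derivative of \<open>x\<^sup>* Q x\<close> along \<open>x' = M x\<close> is twice \<open>Re ((M x)\<^sup>* Q x)\<close>, so the hypothesis on \<open>M\<close>
  is a linear differential equation for the energy, and the weight \<open>exp (2 \<beta> t)\<close> turns it into a constant.
\<close>

lemma energy_along_flow:
  fixes M Q :: "complex^'n^'n"
  assumes herm: "conj_transpose Q = Q"
    and diss: "\<And>x. inner (M *v x) (Q *v x) = - \<beta> * inner x (Q *v x)"
  shows "inner (matrix_exp (t *\<^sub>R M) *v v) (Q *v (matrix_exp (t *\<^sub>R M) *v v))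
           = exp (- 2 * \<beta> * t) * inner v (Q *v v)"
proof -
  define x where "x = (\<lambda>t. matrix_exp (t *\<^sub>R M) *v v)"
  define g where "g = (\<lambda>t. exp (2 * \<beta> * t) * inner (x t) (Q *v x t))"
  have x: "(x has_vector_derivative M *v x t) (at t)" for t
    unfolding x_def matrix_vector_mul_assoc
    by (rule bounded_linear.has_vector_derivative
        [OF bounded_bilinear.bounded_linear_left[OF bounded_bilinear_matrix_vector_mult]
          has_vector_derivative_matrix_exp])
  have Qx: "((\<lambda>t. Q *v x t) has_vector_derivative Q *v (M *v x t)) (at t)" for t
    by (rule bounded_linear.has_vector_derivative
        [OF bounded_bilinear.bounded_linear_right[OF bounded_bilinear_matrix_vector_mult] x])
  have "inner (x t) (Q *v (M *v x t)) = - \<beta> * inner (x t) (Q *v x t)" for t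
    using inner_conj_transpose[of Q "x t" "M *v x t"] diss[of "x t"] by (simp add: herm inner_commute)
  then have "((\<lambda>t. inner (x t) (Q *v x t)) has_vector_derivative
      - 2 * \<beta> * inner (x t) (Q *v x t)) (at t)" for t
    using bounded_bilinear.has_vector_derivative[OF bounded_bilinear_inner x Qx, of t] diss[of "x t"]
    by (simp add: algebra_simps)
  then have inner_der: "((\<lambda>t. inner (x t) (Q *v x t)) has_real_derivative
      - 2 * \<beta> * inner (x t) (Q *v x t)) (at t)" for t
    by (simp add: has_real_derivative_iff_has_vector_derivative)
  have "DERIV g t :> 0" for t
    unfolding g_def by (rule derivative_eq_intros inner_der refl | simp add: algebra_simps)+
  then have "g t = g 0" using DERIV_isconst_all by blast
  then have "exp (2 * \<beta> * t) * inner (x t) (Q *v x t) = inner v (Q *v v)"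
    by (simp add: g_def x_def matrix_exp_0)
  then show ?thesis
    by (simp add: x_def exp_minus field_simps)
qed

lemma matrix_exp_decay:
  fixes M Q :: "complex^'n^'n"
  assumes herm: "conj_transpose Q = Q"
    and diss: "\<And>x. inner (M *v x) (Q *v x) = - \<beta> * inner x (Q *v x)"
    and q: "q > 0" "\<And>x. q * (norm x)\<^sup>2 \<le> inner x (Q *v x)" and b: "norm Q \<le> b"
  shows "norm (matrix_exp (t *\<^sub>R M) *v v) \<le> sqrt (b / q) * exp (- \<beta> * t) * norm v"
proof -
  let ?x = "matrix_exp (t *\<^sub>R M) *v v"
  have "inner v (Q *v v) \<le> norm v * (norm Q * norm v)"
    using norm_cauchy_schwarz[of v "Q *v v"] norm_matrix_vector_mult_le[of Q v]
    by (meson mult_left_mono norm_ge_zero order_trans)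
  also have "\<dots> \<le> norm v * (b * norm v)"
    by (intro mult_left_mono mult_right_mono b) auto
  finally have v: "inner v (Q *v v) \<le> b * (norm v)\<^sup>2" by (simp add: power2_eq_square mult_ac)
  have "q * (norm ?x)\<^sup>2 \<le> exp (- 2 * \<beta> * t) * inner v (Q *v v)"
    using q(2)[of ?x] energy_along_flow[OF herm diss, of t v] by simp
  also have "\<dots> \<le> exp (- 2 * \<beta> * t) * (b * (norm v)\<^sup>2)"
    by (intro mult_left_mono v) simp
  also have "exp (- 2 * \<beta> * t) = (exp (- \<beta> * t))\<^sup>2"
    by (simp add: power2_eq_square flip: exp_add)
  finally have "(norm ?x)\<^sup>2 \<le> (b / q) * (exp (- \<beta> * t) * norm v)\<^sup>2"
    using q(1) by (simp add: field_simps power_mult_distrib)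
  then have "sqrt ((norm ?x)\<^sup>2) \<le> sqrt ((b / q) * (exp (- \<beta> * t) * norm v)\<^sup>2)"
    by (rule real_sqrt_le_mono)
  also have "\<dots> = sqrt (b / q) * sqrt ((exp (- \<beta> * t) * norm v)\<^sup>2)"
    by (rule real_sqrt_mult)
  finally show ?thesis by (simp add: mult.assoc)
qed

section \<open>Multiplication operators\<close>

lemma norm_le_sup_norm:
  assumes "compact P" "f \<in> cont_space P" "\<theta> \<in> P"
  shows "norm (f \<theta>) \<le> sup_norm P f"
proof -
  have "compact ((\<lambda>\<theta>. norm (f \<theta>)) ` P)"
    using assms by (intro compact_continuous_image continuous_on_norm) (auto simp: cont_space_def)
  then show ?thesis
    unfolding sup_norm_def
    by (intro cSUP_upper assms(3) bounded_imp_bdd_above compact_imp_bounded)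
qed

lemma sup_norm_le:
  "P \<noteq> {} \<Longrightarrow> (\<And>\<theta>. \<theta> \<in> P \<Longrightarrow> norm (f \<theta>) \<le> c) \<Longrightarrow> sup_norm P f \<le> c"
  unfolding sup_norm_def by (rule cSUP_least)

lemma mult_op_cont_space:
  assumes "continuous_on P F" "f \<in> cont_space P"
  shows "mult_op P F f \<in> cont_space P"
proof -
  have "continuous_on P (\<lambda>\<theta>. F \<theta> *v f \<theta>)"
    using assms by (intro continuous_on_matrix_vector_mult) (auto simp: cont_space_def)
  then show ?thesis
    using continuous_on_cong[of P P "mult_op P F f" "\<lambda>\<theta>. F \<theta> *v f \<theta>"]
    by (auto simp: cont_space_def mult_op_def)
qed

text \<open>
  Lets the bounds below be stated without a separate sign condition on the constant.
\<close>

lemma nonneg_if_bounds_norm: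
  fixes F :: "complex^'n^'m"
  assumes "\<And>v. norm (F *v v) \<le> c * norm v"
  shows "0 \<le> c"
proof -
  have "0 \<le> c * norm (axis undefined 1 :: complex^'n)"
    using assms norm_ge_zero order_trans by blast
  moreover have "0 < norm (axis undefined 1 :: complex^'n)" by (simp add: axis_eq_0_iff)
  ultimately show ?thesis by (simp add: zero_le_mult_iff)
qed

lemma sup_norm_mult_op_le:
  assumes P: "P \<noteq> {}" "compact P" and f: "f \<in> cont_space P"
    and c: "\<And>\<theta> v. \<theta> \<in> P \<Longrightarrow> norm (F \<theta> *v v) \<le> c * norm v"
  shows "sup_norm P (mult_op P F f) \<le> c * sup_norm P f"
proof (rule sup_norm_le[OF P(1)])
  fix \<theta> assume \<theta>: "\<theta> \<in> P"
  have "c \<ge> 0" by (rule nonneg_if_bounds_norm[OF c[OF \<theta>]])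
  then show "norm (mult_op P F f \<theta>) \<le> c * sup_norm P f"
    using c[OF \<theta>, of "f \<theta>"] mult_left_mono[OF norm_le_sup_norm[OF P(2) f \<theta>], of c] \<theta>
    by (simp add: mult_op_def)
qed

lemma bounded_operator_mult_op:
  assumes P: "P \<noteq> {}" "compact P" and F: "continuous_on P F"
  shows "bounded_operator P (mult_op P F)"
proof -
  obtain r where r: "\<And>\<theta>. \<theta> \<in> P \<Longrightarrow> norm (F \<theta>) \<le> r"
    using compact_imp_bounded[OF compact_continuous_image[OF F P(2)]] by (auto simp: bounded_iff)
  have "norm (F \<theta> *v v) \<le> r * norm v" if "\<theta> \<in> P" for \<theta> v
    using norm_matrix_vector_mult_le[of "F \<theta>" v] mult_right_mono[OF r[OF that], of "norm v"] by simp
  then have "\<exists>c. \<forall>f\<in>cont_space P. sup_norm P (mult_op P F f) \<le> c * sup_norm P f"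
    using sup_norm_mult_op_le[OF P] by blast
  moreover have "F \<theta> *v (c *s v) = c *s (F \<theta> *v v)" for \<theta> c v
    by (simp add: vec_eq_iff matrix_vector_mult_def sum_distrib_left mult_ac)
  ultimately show ?thesis
    using mult_op_cont_space[OF F]
    by (auto simp: bounded_operator_def mult_op_def matrix_vector_right_distrib)
qed

text \<open>
  The lower bound is part of the lemma because \<^const>\<open>op_norm\<close> is a supremum of reals, which carries
  information only once the set is known to be bounded. The operator \<open>G\<close> is prescribed only on
  \<^term>\<open>cont_space P\<close>, as a power series in a multiplication operator need not be a multiplication
  operator elsewhere: its term of order zero is the identity.
\<close>

lemma op_norm_mult_op_bounds:
  fixes F :: "complex \<Rightarrow> complex^'n^'n"
  assumes P: "P \<noteq> {}" "compact P"
    and c: "\<And>\<theta> v. \<theta> \<in> P \<Longrightarrow> norm (F \<theta> *v v) \<le> c * norm v"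
    and G: "\<And>f. f \<in> cont_space P \<Longrightarrow> G f = mult_op P F f"
  shows "0 \<le> op_norm P G" and "op_norm P G \<le> c"
proof -
  let ?U = "{f \<in> cont_space P. sup_norm P (f :: complex \<Rightarrow> complex^'n) \<le> 1}"
  have zero: "(\<lambda>\<theta>. 0) \<in> ?U" by (auto simp: cont_space_def sup_norm_def P)
  have "c \<ge> 0" using nonneg_if_bounds_norm[OF c] P by blast
  have le: "sup_norm P (G f) \<le> c" if "f \<in> ?U" for f
    using sup_norm_mult_op_le[OF P, of f F c] that c mult_left_mono[OF _ \<open>c \<ge> 0\<close>, of "sup_norm P f" 1]
    by (simp add: G)
  then show "op_norm P G \<le> c"
    unfolding op_norm_def using zero by (intro cSUP_least) auto
  have "G (\<lambda>\<theta>. 0) = (\<lambda>\<theta>. 0)"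
    using zero G[of "\<lambda>\<theta>. 0"]
    by (auto simp: mult_op_def fun_eq_iff bounded_bilinear.zero_right[OF bounded_bilinear_matrix_vector_mult])
  then have "0 = sup_norm P (G (\<lambda>\<theta>. 0))"
    using P by (simp add: sup_norm_def)
  also have "\<dots> \<le> op_norm P G"
    unfolding op_norm_def using zero le by (intro cSUP_upper bdd_aboveI2) auto
  finally show "0 \<le> op_norm P G" .
qed

lemma mult_op_power:
  assumes "f \<in> cont_space P"
  shows "(mult_op P X ^^ k) f = mult_op P (\<lambda>\<theta>. mpow (X \<theta>) k) f"
proof (induction k)
  case 0
  then show ?case using assms by (auto simp: mult_op_def cont_space_def)
next
  case (Suc k)
  then show ?case by (auto simp: mult_op_def matrix_vector_mul_assoc)
qed

text \<open>
  On continuous functions the error of a partial sum is multiplication by the matrix function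
  \<open>R N\<close>, so its operator norm is controlled by the supremum of \<open>|R N \<theta>|\<close>; uniform convergence of
  the exponential series on the compact range of \<open>X\<close> sends it to zero.
\<close>

lemma has_op_exp_mult_op:
  fixes X :: "complex \<Rightarrow> complex^'n^'n"
  assumes P: "P \<noteq> {}" "compact P" and X: "continuous_on P X"
  shows "has_op_exp P (mult_op P X) (mult_op P (\<lambda>\<theta>. matrix_exp (X \<theta>)))"
proof -
  define R where "R = (\<lambda>N \<theta>. (\<Sum>k<N. (1 / fact k) *\<^sub>R mpow (X \<theta>) k) - matrix_exp (X \<theta>))"
  define G where "G = (\<lambda>N f \<theta>. (\<Sum>k<N. (1 / fact k) *\<^sub>R (mult_op P X ^^ k) f \<theta>)
      - mult_op P (\<lambda>\<theta>. matrix_exp (X \<theta>)) f \<theta>)"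
  have G: "G N f = mult_op P (R N) f" if "f \<in> cont_space P" for N f
  proof
    fix \<theta>
    have "(\<Sum>k<N. (1 / fact k) *\<^sub>R mpow (X \<theta>) k) *v f \<theta> = (\<Sum>k<N. (1 / fact k) *\<^sub>R (mpow (X \<theta>) k *v f \<theta>))"
      by (simp add: bounded_bilinear.sum_left[OF bounded_bilinear_matrix_vector_mult] scaleR_matrix_vector_mult)
    then show "G N f \<theta> = mult_op P (R N) f \<theta>"
      by (simp add: G_def R_def mult_op_power[OF that] mult_op_def matrix_vector_mult_diff_rdistrib)
  qed
  obtain r where r: "\<And>\<theta>. \<theta> \<in> P \<Longrightarrow> norm (X \<theta>) \<le> r"
    using compact_imp_bounded[OF compact_continuous_image[OF X P(2)]] by (auto simp: bounded_iff)
  have "(\<lambda>N. op_norm P (G N)) \<longlonglongrightarrow> 0"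
  proof (rule tendstoI)
    fix e :: real assume e: "e > 0"
    have "\<forall>\<^sub>F N in sequentially. \<forall>\<theta>\<in>P. norm (R N \<theta>) < e / 2"
      using uniform_limitD[OF uniform_limit_matrix_exp[of P X r, OF r] half_gt_zero[OF e]] e
      by (simp add: dist_norm R_def)
    then show "\<forall>\<^sub>F N in sequentially. dist (op_norm P (G N)) 0 < e"
    proof eventually_elim
      case (elim N)
      have "norm (R N \<theta> *v v) \<le> e / 2 * norm v" if "\<theta> \<in> P" for \<theta> v
        using norm_matrix_vector_mult_le[of "R N \<theta>" v] elim that
          mult_right_mono[of "norm (R N \<theta>)" "e / 2" "norm v"] by (auto dest!: bspec)
      from op_norm_mult_op_bounds[OF P this G] show ?case using e by simp
    qed
  qed
  then show ?thesis
    using bounded_operator_mult_op[OF P continuous_on_matrix_exp[OF P(2) X]]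
    by (simp add: has_op_exp_def G_def)
qed

lemma exponentially_stable_mult_op:
  fixes M :: "complex \<Rightarrow> complex^'n^'n"
  assumes P: "P \<noteq> {}" "compact P" and M: "continuous_on P M" and "\<gamma> > 0"
    and decay: "\<And>\<theta> t v. \<theta> \<in> P \<Longrightarrow> t \<ge> 0 \<Longrightarrow> norm (matrix_exp (t *\<^sub>R M \<theta>) *v v) \<le> C * exp (- \<gamma> * t) * norm v"
  shows "exponentially_stable P (mult_op P M)"
proof -
  have "\<exists>E. has_op_exp P (\<lambda>f \<theta>. t *\<^sub>R mult_op P M f \<theta>) E \<and> op_norm P E \<le> max 1 C * exp (- \<gamma> * t)"
    if t: "t \<ge> 0" for t
  proof -
    let ?E = "mult_op P (\<lambda>\<theta>. matrix_exp (t *\<^sub>R M \<theta>))"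
    have "(\<lambda>f \<theta>. t *\<^sub>R mult_op P M f \<theta>) = mult_op P (\<lambda>\<theta>. t *\<^sub>R M \<theta>)"
      by (auto simp: mult_op_def fun_eq_iff scaleR_matrix_vector_mult)
    moreover have "has_op_exp P (mult_op P (\<lambda>\<theta>. t *\<^sub>R M \<theta>)) ?E"
      by (intro has_op_exp_mult_op P continuous_intros M)
    moreover have "op_norm P ?E \<le> max 1 C * exp (- \<gamma> * t)"
    proof -
      have "op_norm P ?E \<le> C * exp (- \<gamma> * t)"
        by (rule op_norm_mult_op_bounds(2)[OF P decay[OF _ t] refl])
      also have "\<dots> \<le> max 1 C * exp (- \<gamma> * t)" by (intro mult_right_mono) auto
      finally show ?thesis .
    qed
    ultimately show ?thesis by auto
  qed
  moreover have "bounded_operator P (mult_op P M)" by (rule bounded_operator_mult_op[OF P M])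
  ultimately show ?thesis
    unfolding exponentially_stable_def using \<open>\<gamma> > 0\<close>
    by (intro conjI, simp) (rule exI[of _ "max 1 C"], rule exI[of _ \<gamma>], auto)
qed

section \<open>Continuous stabilising feedback\<close>

theorem theorem3p10:
  fixes P :: "complex set"
    and A :: "complex \<Rightarrow> complex^'n::{finite,linorder}^'n::{finite,linorder}"
    and B :: "complex \<Rightarrow> complex^'m::{finite,linorder}^'n::{finite,linorder}"
  assumes "P \<noteq> {}" and "compact P"
    and "continuous_on P A" and "continuous_on P B"
    and "pointwise_reachable P A B"
    and "constant_hermite_indices P A B"
  shows "\<exists>K :: complex \<Rightarrow> complex^'n::{finite,linorder}^'m::{finite,linorder}. continuous_on P K \<and>
           exponentially_stable P (mult_op P (\<lambda>\<theta>. A \<theta> + B \<theta> ** K \<theta>))"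
proof -
  note P = \<open>P \<noteq> {}\<close> \<open>compact P\<close> and A = \<open>continuous_on P A\<close> and B = \<open>continuous_on P B\<close>
  have reach: "reachable (A \<theta>) (B \<theta>)" if "\<theta> \<in> P" for \<theta>
    using \<open>pointwise_reachable P A B\<close> that by (simp add: pointwise_reachable_def)
  obtain a where a: "\<And>\<theta>. \<theta> \<in> P \<Longrightarrow> norm (A \<theta>) \<le> a"
    using compact_imp_bounded[OF compact_continuous_image[OF A P(2)]] by (auto simp: bounded_iff)
  (* one more than the norm bound, so that the lower bound of the Lyapunov map is uniform in \<theta> *)
  define \<beta> where "\<beta> = \<bar>a\<bar> + 1"
  have \<beta>: "\<beta> > 0" "\<And>\<theta>. \<theta> \<in> P \<Longrightarrow> norm (A \<theta>) + 1 \<le> \<beta>"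
    using order_trans[OF a abs_ge_self] by (auto simp: \<beta>_def)
  have A\<beta>: "norm (A \<theta>) < \<beta>" if "\<theta> \<in> P" for \<theta> using \<beta>(2)[OF that] by simp
  define BB where "BB = (\<lambda>\<theta>. 2 *\<^sub>R (B \<theta> ** conj_transpose (B \<theta>)))"
  define Z where "Z = (\<lambda>\<theta>. inv (lyapunov_map (A \<theta>) \<beta>) (BB \<theta>))"
  have sol: "lyapunov_map (A \<theta>) \<beta> (Z \<theta>) = BB \<theta>" if "\<theta> \<in> P" for \<theta>
    unfolding Z_def by (rule surj_f_inv_f[OF bij_is_surj[OF bij_lyapunov_map[OF A\<beta>[OF that]]]])
  have Z_herm: "conj_transpose (Z \<theta>) = Z \<theta>" if "\<theta> \<in> P" for \<theta>
    by (rule lyapunov_solution_hermitian[OF A\<beta>[OF that] sol[OF that]])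
       (simp add: BB_def conj_transpose_scaleR conj_transpose_matrix_mult)
  have Z_pos: "0 < inner x (Z \<theta> *v x)" if "\<theta> \<in> P" "x \<noteq> 0" for \<theta> x
    using lyapunov_solution_positive_definite[OF reach A\<beta> sol[unfolded BB_def]] that by blast
  have Z_cont: "continuous_on P Z"
  proof (rule continuous_on_solution[where T = "\<lambda>\<theta>. lyapunov_map (A \<theta>) \<beta>" and b = BB and c = 2])
    show "2 * norm X \<le> norm (lyapunov_map (A \<theta>) \<beta> X)" if "\<theta> \<in> P" for \<theta> X
      using lyapunov_map_lower_bound[of \<beta> "A \<theta>" X] \<beta>(2)[OF that]
        mult_right_mono[of 2 "2 * (\<beta> - norm (A \<theta>))" "norm X"] by simp
    show "continuous_on P (\<lambda>\<theta>. lyapunov_map (A \<theta>) \<beta> X)" for X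
      unfolding lyapunov_map_def
      by (intro continuous_intros continuous_on_matrix_matrix_mult continuous_on_conj_transpose A)
    show "continuous_on P BB"
      unfolding BB_def
      by (intro continuous_intros continuous_on_matrix_matrix_mult continuous_on_conj_transpose B)
  qed (simp_all add: linear_lyapunov_map sol)
  obtain z where z: "z > 0" "\<And>\<theta> x. \<theta> \<in> P \<Longrightarrow> z * (norm x)\<^sup>2 \<le> inner x (Z \<theta> *v x)"
    using uniformly_positive_definite[OF P(2,1) Z_cont Z_pos] by blast
  have z_bound: "z * norm x \<le> norm (Z \<theta> *v x)" if "\<theta> \<in> P" for \<theta> x
  proof (cases "x = 0")
    case False
    have "z * norm x * norm x \<le> norm (Z \<theta> *v x) * norm x"
      using z(2)[OF that, of x] norm_cauchy_schwarz[of x "Z \<theta> *v x"]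
      by (simp add: power2_eq_square mult_ac)
    then show ?thesis using False by simp
  qed simp

  define Q where "Q = (\<lambda>\<theta>. matrix_inv (Z \<theta>))"
  have inv: "Z \<theta> ** Q \<theta> = mat 1 \<and> Q \<theta> ** Z \<theta> = mat 1" if "\<theta> \<in> P" for \<theta>
  proof -
    have "x = 0" if "Z \<theta> *v x = 0" for x using z_bound[OF \<open>\<theta> \<in> P\<close>, of x] that z(1) by (simp add: mult_le_0_iff)
    then obtain Y where "Y ** Z \<theta> = mat 1" using matrix_left_invertible_ker by blast
    then have "invertible (Z \<theta>)" using invertible_left_inverse by blast
    then show ?thesis
      unfolding Q_def matrix_inv_def invertible_def by (rule someI_ex)
  qed
  have ZQ: "Z \<theta> *v (Q \<theta> *v x) = x" if "\<theta> \<in> P" for \<theta> x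
    using inv[OF that] by (simp add: matrix_vector_mul_assoc)
  have Q_cont: "continuous_on P Q"
  proof -
    have "continuous_on P (\<lambda>\<theta>. Q \<theta> *v x)" for x
      by (rule continuous_on_solution[where T = "\<lambda>\<theta> y. Z \<theta> *v y" and b = "\<lambda>\<theta>. x" and c = z])
         (auto simp: z z_bound ZQ intro!: bounded_linear.linear bounded_bilinear.bounded_linear_right
            bounded_bilinear_matrix_vector_mult continuous_on_matrix_vector_mult Z_cont)
    then have "continuous_on P (\<lambda>\<theta>. \<chi> i j. (Q \<theta> *v axis j 1) $ i)"
      by (intro continuous_intros)
    moreover have "(\<chi> i j. (Q \<theta> *v axis j 1) $ i) = Q \<theta>" for \<theta>
      by (simp add: vec_eq_iff matrix_vector_mult_def axis_def if_distrib cong: if_cong)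
    ultimately show ?thesis by simp
  qed
  have Q_herm: "conj_transpose (Q \<theta>) = Q \<theta>" if "\<theta> \<in> P" for \<theta>
  proof -
    have "conj_transpose (Z \<theta> ** Q \<theta>) = mat 1"
      using inv[OF that] by (simp add: conj_transpose_def mat_def vec_eq_iff)
    then have "conj_transpose (Q \<theta>) ** Z \<theta> = mat 1"
      by (simp add: conj_transpose_matrix_mult Z_herm[OF that])
    then have "conj_transpose (Q \<theta>) ** (Z \<theta> ** Q \<theta>) = Q \<theta>"
      by (simp add: matrix_mul_assoc)
    then show ?thesis using inv[OF that] by simp
  qed
  have Q_pos: "0 < inner x (Q \<theta> *v x)" if "\<theta> \<in> P" "x \<noteq> 0" for \<theta> x
  proof -
    have "Q \<theta> *v x \<noteq> 0" using ZQ[OF that(1), of x] that(2) by auto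
    then show ?thesis using Z_pos[OF that(1)] ZQ[OF that(1), of x] by (metis inner_commute)
  qed
  obtain q where q: "q > 0" "\<And>\<theta> x. \<theta> \<in> P \<Longrightarrow> q * (norm x)\<^sup>2 \<le> inner x (Q \<theta> *v x)"
    using uniformly_positive_definite[OF P(2,1) Q_cont Q_pos] by blast
  obtain b where b: "\<And>\<theta>. \<theta> \<in> P \<Longrightarrow> norm (Q \<theta>) \<le> b"
    using compact_imp_bounded[OF compact_continuous_image[OF Q_cont P(2)]] by (auto simp: bounded_iff)

  define K where "K = (\<lambda>\<theta>. - (conj_transpose (B \<theta>) ** Q \<theta>))"
  have K: "continuous_on P K"
    unfolding K_def
    by (intro continuous_intros continuous_on_matrix_matrix_mult continuous_on_conj_transpose B Q_cont)
  have diss: "inner ((A \<theta> + B \<theta> ** K \<theta>) *v x) (Q \<theta> *v x) = - \<beta> * inner x (Q \<theta> *v x)"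
    if "\<theta> \<in> P" for \<theta> x
    unfolding K_def
    using bass_feedback_dissipation[OF sol[unfolded BB_def] Z_herm] inv that by blast
  have "exponentially_stable P (mult_op P (\<lambda>\<theta>. A \<theta> + B \<theta> ** K \<theta>))"
  proof (rule exponentially_stable_mult_op[OF P _ \<beta>(1)])
    show "continuous_on P (\<lambda>\<theta>. A \<theta> + B \<theta> ** K \<theta>)"
      by (intro continuous_intros continuous_on_matrix_matrix_mult A B K)
    show "norm (matrix_exp (t *\<^sub>R (A \<theta> + B \<theta> ** K \<theta>)) *v v) \<le> sqrt (b / q) * exp (- \<beta> * t) * norm v"
      if "\<theta> \<in> P" for \<theta> t v
      using matrix_exp_decay[OF Q_herm diss q(1) q(2) b] that by blast
  qed
  with K show ?thesis by blast
qed

end
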